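(* Let $A=A^*\in\mathbb{C}^{n\times n}$, $B=B^*\in\mathbb{C}^{n\times n}$ with $B$ positive definite, and let $\lambda_q$ be a simple eigenvalue of the pencil $A-\lambda B$. Set $M=A-\lambda_q B$. Let $T\in\mathbb{C}^{n\times n}$ be Hermitian positive definite. Consider the iteration $$v^{(i+1)} = v^{(i)} + \alpha^{(i)} T r^{(i)} + \beta^{(i)} T M T r^{(i)},\qquad i=0,1,\ldots,$$ where $r^{(i)} = (\lambda_q B - A)v^{(i)} = -Mv^{(i)}$, and the scalars $\alpha^{(i)},\beta^{(i)}\in\mathbb{C}$ are chosen so that $$\|r^{(i+1)}\|_T = \min_{u\in\mathcal{K}^{(i)}} \|r^{(i)} - M u\|_T,\qquad \mathcal{K}^{(i)}=\operatorname{span}\{Tr^{(i)},\, TMTr^{(i)}\},$$ with $\|x\|_T=(x,Tx)^{1/2}$. Let $\mu_1\le\cdots\le\mu_{q-1}<\mu_q=0<\mu_{q+1}\le\cdots\le\mu_n$ be the (real) eigenvalues of $TM$, where $2\le q\le n-1$. Write $v^{(0)}=x_0+y_0$ with $x_0\in\ker M$ and $y_0\in\operatorname{range}(TM)$, and assume $x_0\ne 0$. Then the iterates $v^{(i)}$ converge to a nonzero vector in $\ker M$ (i.e., an eigenvector of the pencil for $\lambda_q$), and for every $i$, $$\frac{\|r^{(i+1)}\|_T}{\|r^{(i)}\|_T}\le\frac{\tilde\kappa-1}{\tilde\kappa+1}<1,$$ where $$\tilde\kappa=\begin{cases}\dfrac{\mu_n}{\mu_{q+1}}\left(1+\dfrac{\mu_n-\mu_{q+1}}{|\mu_{q-1}|}\right),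 & \text{if } |\mu_1|-|\mu_{q-1}|\le \mu_n-\mu_{q+1},\\[2ex] \dfrac{\mu_1}{\mu_{q-1}}\left(1+\dfrac{|\mu_1|-|\mu_{q-1}|}{\mu_{q+1}}\right), & \text{if } |\mu_1|-|\mu_{q-1}|> \mu_n-\mu_{q+1}.\end{cases}$$
   Context: For a Hermitian positive definite matrix $T$, $\|x\|_T=(x,Tx)^{1/2}$. The eigenvalues of $TM$ are real since $TM$ is similar to the Hermitian matrix $T^{1/2}MT^{1/2}$; simplicity of $\lambda_q$ means $\ker M$ is one-dimensional, so exactly one eigenvalue of $TM$ is zero. The hypothesis $2\le q\le n-1$ means $M$ is indefinite. *)

theory Defs
  imports "Jordan_Normal_Form.Schur_Decomposition" "Jordan_Normal_Form.Char_Poly"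
    "Jordan_Normal_Form.Matrix_Kernel"
begin

definition hermitian_mat :: "nat \<Rightarrow> complex mat \<Rightarrow> bool" where
  "hermitian_mat n A \<longleftrightarrow> A \<in> carrier_mat n n \<and> mat_adjoint A = A"

definition pos_def_mat :: "nat \<Rightarrow> complex mat \<Rightarrow> bool" where
  "pos_def_mat n A \<longleftrightarrow> hermitian_mat n A \<and>
     (\<forall>x \<in> carrier_vec n. x \<noteq> 0\<^sub>v n \<longrightarrow> 0 < Re ((A *\<^sub>v x) \<bullet>c x))"

definition pencil_poly :: "complex mat \<Rightarrow> complex mat \<Rightarrow> complex poly" where
  "pencil_poly A B = det (mat (dim_row A) (dim_row A) (\<lambda>(i,j). [: A $$ (i,j), - (B $$ (i,j)) :]))"

definition simple_pencil_eigenvalue :: "complex mat \<Rightarrow> complex mat \<Rightarrow> complex \<Rightarrow> bool" where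
  "simple_pencil_eigenvalue A B l \<longleftrightarrow>
     pencil_poly A B \<noteq> 0 \<and> poly (pencil_poly A B) l = 0 \<and> order l (pencil_poly A B) = 1"

definition normT :: "complex mat \<Rightarrow> complex vec \<Rightarrow> real" where
  "normT T x = sqrt (Re ((T *\<^sub>v x) \<bullet>c x))"

definition kappa_tilde :: "real \<Rightarrow> real \<Rightarrow> real \<Rightarrow> real \<Rightarrow> real" where
  "kappa_tilde m1 mqm mqp mn =
     (if \<bar>m1\<bar> - \<bar>mqm\<bar> \<le> mn - mqp
      then mn / mqp * (1 + (mn - mqp) / \<bar>mqm\<bar>)
      else m1 / mqm * (1 + (\<bar>m1\<bar> - \<bar>mqm\<bar>) / mqp))"

end

theory Submission
  imports Defs
begin

text \<open>Writing \<open>T = P P\<^sup>*\<close> with \<open>P\<^sup>* M P = diag(\<mu>\<^sub>1, \<dots>, \<mu>\<^sub>n)\<close>, the coordinates \<open>u = P\<^sup>-\<^sup>1 v\<close> and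
  \<open>s = P\<^sup>* r\<close> decouple the iteration: \<open>s\<^sub>j = - \<mu>\<^sub>j u\<^sub>j\<close>, the \<open>T\<close>-norm of \<open>r\<close> is the Euclidean norm
  of \<open>s\<close>, and a residual of the search space is \<open>(1 - a \<mu>\<^sub>j - b \<mu>\<^sub>j\<^sup>2) s\<^sub>j\<close>.  A quadratic that is small
  on both spectral intervals gives the rate.  Hence \<open>s\<close> tends to \<open>0\<close>, so \<open>u\<^sub>j\<close> tends to \<open>0\<close> for
  \<open>j \<noteq> q\<close>, while \<open>u\<^sub>q\<close> never changes; therefore \<open>v\<close> tends to \<open>x0\<close>.\<close>

section \<open>Adjoints of complex matrices and the complex inner product\<close>

lemma mat_adjoint_dim [simp]:
  "dim_row (mat_adjoint A) = dim_col A" "dim_col (mat_adjoint A) = dim_row A"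
  unfolding mat_adjoint_def by auto

lemma mat_adjoint_carrier [simp]:
  "A \<in> carrier_mat n m \<Longrightarrow> mat_adjoint A \<in> carrier_mat m n"
  by (intro carrier_matI) auto

lemma mat_adjoint_index [simp]:
  assumes "i < dim_col A" "j < dim_row A"
  shows "mat_adjoint A $$ (i, j) = conjugate (A $$ (j, i))"
  using assms unfolding mat_adjoint_def by (auto simp: mat_of_rows_index)

lemma mat_adjoint_adjoint [simp]: "mat_adjoint (mat_adjoint A) = A"
  by (rule eq_matI) auto

lemma row_mat_adjoint [simp]: "i < dim_col A \<Longrightarrow> row (mat_adjoint A) i = conjugate (col A i)"
  by (intro eq_vecI) auto

lemma mat_adjoint_mult:
  fixes A B :: "complex mat"
  assumes "A \<in> carrier_mat n m" "B \<in> carrier_mat m k"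
  shows "mat_adjoint (A * B) = mat_adjoint B * mat_adjoint A"
  using assms by (intro eq_matI) (auto simp: scalar_prod_def mult.commute)

lemma mat_adjoint_one [simp]: "mat_adjoint (1\<^sub>m n :: complex mat) = 1\<^sub>m n"
  by (rule eq_matI) auto

lemma mat_adjoint_mat_diag:
  "mat_adjoint (mat_diag n f) = mat_diag n (\<lambda>i. cnj (f i))"
  by (rule eq_matI) (auto simp: mat_diag_def)

lemma mat_adjoint_four_block:
  fixes A :: "complex mat"
  assumes "A \<in> carrier_mat n1 m1" "B \<in> carrier_mat n1 m2" "C \<in> carrier_mat n2 m1" "D \<in> carrier_mat n2 m2"
  shows "mat_adjoint (four_block_mat A B C D)
    = four_block_mat (mat_adjoint A) (mat_adjoint C) (mat_adjoint B) (mat_adjoint D)"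
  using assms by (intro eq_matI) auto

lemma mat_mult_cscalar_prod_adjoint:
  fixes A :: "complex mat"
  assumes A: "A \<in> carrier_mat n m" and x: "x \<in> carrier_vec m" and y: "y \<in> carrier_vec n"
  shows "(A *\<^sub>v x) \<bullet>c y = x \<bullet>c (mat_adjoint A *\<^sub>v y)"
proof -
  have "(A *\<^sub>v x) \<bullet>c y = (\<Sum>i<n. \<Sum>j<m. A $$ (i,j) * x $ j * cnj (y $ i))"
    using assms by (simp add: scalar_prod_def sum_distrib_right atLeast0LessThan)
  also have "\<dots> = (\<Sum>j<m. \<Sum>i<n. A $$ (i,j) * x $ j * cnj (y $ i))"
    by (rule sum.swap)
  also have "\<dots> = x \<bullet>c (mat_adjoint A *\<^sub>v y)"
    using assms by (simp add: scalar_prod_def sum_distrib_left atLeast0LessThan mult_ac)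
  finally show ?thesis .
qed

lemma mat_mult_vec_minus:
  fixes A :: "complex mat"
  assumes "A \<in> carrier_mat n m" "x \<in> carrier_vec m" "y \<in> carrier_vec m"
  shows "A *\<^sub>v (x - y) = A *\<^sub>v x - A *\<^sub>v y"
  using assms by (intro eq_vecI) (auto simp: scalar_prod_minus_distrib[of _ m])

lemma cscalar_prod_self:
  "(x :: complex vec) \<bullet>c x = complex_of_real (\<Sum>j<dim_vec x. (cmod (x $ j))\<^sup>2)"
  by (simp add: scalar_prod_def atLeast0LessThan complex_norm_square[symmetric]) 

section \<open>Unitary matrices and the diagonalization of Hermitian matrices\<close>

definition vec_normalize :: "complex vec \<Rightarrow> complex vec" where
  "vec_normalize w = complex_of_real (1 / sqrt (Re (w \<bullet>c w))) \<cdot>\<^sub>v w"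

lemma vec_normalize_carrier [simp]: "w \<in> carrier_vec n \<Longrightarrow> vec_normalize w \<in> carrier_vec n"
  by (simp add: vec_normalize_def)

lemma cscalar_prod_vec_normalize:
  assumes w: "w \<in> carrier_vec n" "w' \<in> carrier_vec n"
  shows "vec_normalize w \<bullet>c vec_normalize w'
    = complex_of_real (1 / sqrt (Re (w \<bullet>c w)) * (1 / sqrt (Re (w' \<bullet>c w')))) * (w \<bullet>c w')"
  using w by (simp add: vec_normalize_def conjugate_smult_vec)

lemma cscalar_prod_vec_normalize_self:
  assumes w: "w \<in> carrier_vec n" and nz: "w \<bullet>c w \<noteq> 0"
  shows "vec_normalize w \<bullet>c vec_normalize w = 1"
proof -
  define a where "a = (\<Sum>j<dim_vec w. (cmod (w $ j))\<^sup>2)"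
  have wa: "w \<bullet>c w = complex_of_real a" unfolding a_def by (rule cscalar_prod_self)
  have "a \<ge> 0" unfolding a_def by (intro sum_nonneg) auto
  with nz wa have "a > 0" by (cases "a = 0") auto
  then have "1 / sqrt a * (1 / sqrt a) * a = 1"
    by (simp add: field_simps)
  then show ?thesis
    unfolding cscalar_prod_vec_normalize[OF w w] wa
    by (metis Re_complex_of_real of_real_1 of_real_mult)
qed

text \<open>Extend \<open>v\<close> to a basis and orthogonalize by Gram-Schmidt, which keeps the
  first vector; normalizing the columns then gives \<open>W\<close>. The scalar \<open>c\<close>
  absorbs the normalization, since only the direction of an eigenvector matters later.\<close>

lemma unitary_completion:
  fixes v :: "complex vec"
  assumes v: "v \<in> carrier_vec n" and v0: "v \<noteq> 0\<^sub>v n" and n: "n \<noteq> 0"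
  shows "\<exists>W c. W \<in> carrier_mat n n \<and> mat_adjoint W * W = 1\<^sub>m n \<and> col W 0 = c \<cdot>\<^sub>v v"
proof -
  interpret cof_vec_space n "TYPE(complex)" .
  define b where "b = basis_completion v"
  define ws where "ws = gram_schmidt n b"
  from basis_completion[OF v v0, folded b_def]
  have dist_b: "distinct b" and indep: "\<not> lin_dep (set b)" and b: "set b \<subseteq> carrier_vec n"
    and hdb: "hd b = v" and len_b: "length b = n" by auto
  from hdb len_b n obtain vs where bv: "b = v # vs" by (cases b) auto
  from gram_schmidt_result[OF b dist_b indep refl, folded ws_def]
  have ws: "set ws \<subseteq> carrier_vec n" "corthogonal ws" "length ws = n"
    by (auto simp: len_b)
  from gram_schmidt_hd[OF v, of vs, folded bv] have hdws: "hd ws = v" unfolding ws_def .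
  have wsi: "ws ! i \<in> carrier_vec n" if "i < n" for i
    using ws that by (meson nth_mem subsetD)
  define W where "W = mat_of_cols n (map vec_normalize ws)"
  have W: "W \<in> carrier_mat n n" unfolding W_def using ws by auto
  have colW: "col W i = vec_normalize (ws ! i)" if "i < n" for i
    unfolding W_def using that ws wsi by (subst col_mat_of_cols) auto
  have "mat_adjoint W * W = 1\<^sub>m n"
  proof (rule eq_matI)
    fix i j assume "i < dim_row (1\<^sub>m n)" "j < dim_col (1\<^sub>m n)"
    then have ij: "i < n" "j < n" by auto
    have "(mat_adjoint W * W) $$ (i, j) = conjugate (col W i) \<bullet> col W j"
      using ij W by auto
    also have "\<dots> = col W j \<bullet>c col W i"
      using W by (metis carrier_matD(1) carrier_vec_conjugate col_carrier_vec col_dim comm_scalar_prod)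
    also have "\<dots> = (if i = j then 1 else 0)"
    proof (cases "i = j")
      case True
      then show ?thesis
        using cscalar_prod_vec_normalize_self[OF wsi[OF ij(1)]] corthogonalD[OF ws(2), of i i] ij ws
        by (simp add: colW)
    next
      case False
      then show ?thesis
        using corthogonalD[OF ws(2), of j i] ij ws
        by (simp add: colW cscalar_prod_vec_normalize[OF wsi wsi])
    qed
    finally show "(mat_adjoint W * W) $$ (i, j) = 1\<^sub>m n $$ (i, j)" using ij by simp
  qed (use W in auto)
  moreover have "col W 0 = complex_of_real (1 / sqrt (Re (v \<bullet>c v))) \<cdot>\<^sub>v v"
    using colW[of 0] n hdws ws(3) hd_conv_nth[of ws] by (cases "ws = []") (simp_all add: vec_normalize_def)
  ultimately show ?thesis using W by blast
qed

text \<open>Deflation: a unitary matrix whose first column is an eigenvector for the head of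
  \<open>es\<close> splits off that eigenvalue, and the remaining Hermitian block has the tail as
  its eigenvalues. Induction along the list keeps the diagonal in the prescribed order, so that a
  sorted list of eigenvalues can be indexed later.\<close>

theorem hermitian_diagonalization:
  fixes A :: "complex mat"
  assumes "hermitian_mat n A" and "char_poly A = (\<Prod>e\<leftarrow>es. [:- e, 1:])"
  shows "\<exists>U \<in> carrier_mat n n. mat_adjoint U * U = 1\<^sub>m n
    \<and> mat_adjoint U * A * U = mat_diag n (\<lambda>i. es ! i)"
  using assms
proof (induction es arbitrary: n A)
  case Nil
  with degree_monic_char_poly[of A n] have "n = 0" by (auto simp: hermitian_mat_def)
  then show ?case
    by (intro bexI[of _ "1\<^sub>m 0"]) (auto simp: mat_diag_def)
next
  case (Cons e es)
  define m where "m = n - 1"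
  from Cons.prems have A: "A \<in> carrier_mat n n" and herm: "mat_adjoint A = A"
    by (auto simp: hermitian_mat_def)
  have cp: "char_poly A = [: -e, 1 :] * (\<Prod>e \<leftarrow> es. [:- e, 1:])" using Cons.prems by auto
  have mon: "monic (\<Prod>e\<leftarrow> es. [:- e, 1:])" by (rule monic_prod_list) auto
  have deg: "degree (char_poly A) = Suc (degree (\<Prod>e\<leftarrow> es. [:- e, 1:]))" unfolding cp
    by (subst degree_mult_eq, insert mon, auto)
  with degree_monic_char_poly[OF A] have n0: "n \<noteq> 0" by auto
  then have n: "n = 1 + m" unfolding m_def by simp
  have "eigenvalue A e" 
    unfolding eigenvalue_root_char_poly[OF A] cp by simp
  then obtain v where "eigenvector A v e" by (auto simp: eigenvalue_def)
  then have v: "v \<in> carrier_vec n" "v \<noteq> 0\<^sub>v n" and Av: "A *\<^sub>v v = e \<cdot>\<^sub>v v"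
    using A by (auto simp: eigenvector_def)
  from unitary_completion[OF v n0] obtain W c where W: "W \<in> carrier_mat n n"
    and WW: "mat_adjoint W * W = 1\<^sub>m n" and W0: "col W 0 = c \<cdot>\<^sub>v v" by blast
  note assoc = assoc_mult_mat[of _ n n _ n _ n] assoc_mult_mat_vec[of _ n n _ n]
  have WW': "W * mat_adjoint W = 1\<^sub>m n"
    by (rule mat_mult_left_right_inverse[OF _ W WW]) (use W in auto)
  define H where "H = mat_adjoint W * A * W"
  have H: "H \<in> carrier_mat n n" using A W by (auto simp: H_def)
  have Hh: "mat_adjoint H = H"
    using A W herm by (simp add: H_def mat_adjoint_mult[of _ n n _ n] assoc)
  \<comment> \<open>The first column of \<open>W\<close> is an eigenvector and is orthogonal to the
    other columns.\<close>
  have colH: "H $$ (i, 0) = (if i = 0 then e else 0)" if i: "i < n" for i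
  proof -
    have "A *\<^sub>v col W 0 = e \<cdot>\<^sub>v col W 0"
      unfolding W0 mult_mat_vec[OF A v(1)] Av by (simp add: smult_smult_assoc mult.commute)
    moreover have "col (A * W) 0 = A *\<^sub>v col W 0"
      using A W n0 by (intro col_mult2[of _ n n _ n]) auto
    ultimately have colAW: "col (A * W) 0 = e \<cdot>\<^sub>v col W 0" by simp
    have "H = mat_adjoint W * (A * W)" unfolding H_def using A W by (intro assoc) auto
    then have "H $$ (i, 0) = conjugate (col W i) \<bullet> (e \<cdot>\<^sub>v col W 0)"
      using i n0 W A by (simp add: colAW)
    also have "\<dots> = e * (conjugate (col W i) \<bullet> col W 0)"
      using W by simp
    also have "conjugate (col W i) \<bullet> col W 0 = (mat_adjoint W * W) $$ (i, 0)"
      using W i n0 by simp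
    also have "\<dots> = (if i = 0 then 1 else 0)" using i n0 by (simp add: WW)
    finally show ?thesis by simp
  qed
  \<comment> \<open>Hermitian symmetry transfers the zeros of the first column to the first row, so
    \<open>H\<close> is block diagonal.\<close>
  have H0': "H $$ (0, i) = (if i = 0 then e else 0)" if "i < n" for i
  proof (cases "i = 0")
    case False
    have "H $$ (0, i) = cnj (H $$ (i, 0))"
      using arg_cong[OF Hh, of "\<lambda>X. X $$ (0, i)"] H that n0 by simp
    then show ?thesis using colH[OF that] False by simp
  qed (use colH that in simp)
  define K where "K = mat m m (\<lambda>(i, j). H $$ (Suc i, Suc j))"
  define A1 where "A1 = mat 1 1 (\<lambda>_. e)"
  have K: "K \<in> carrier_mat m m" and A1: "A1 \<in> carrier_mat 1 1" by (auto simp: K_def A1_def)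
  have HK: "H = four_block_mat A1 (0\<^sub>m 1 m) (0\<^sub>m m 1) K"
    using H n colH H0' by (intro eq_matI) (auto simp: K_def A1_def)
  have Kh: "hermitian_mat m K"
  proof -
    have "cnj (H $$ (Suc j, Suc i)) = H $$ (Suc i, Suc j)" if "i < m" "j < m" for i j
      using arg_cong[OF Hh, of "\<lambda>X. X $$ (Suc i, Suc j)"] H that n by auto
    then show ?thesis unfolding hermitian_mat_def by (auto simp: K_def intro!: eq_matI)
  qed
  \<comment> \<open>Similarity preserves the characteristic polynomial and the block form makes it a
    product; cancelling the linear factor of \<open>e\<close> leaves exactly the tail for
    \<open>K\<close>, as the induction hypothesis demands.\<close>
  have "similar_mat H A"
    by (rule similar_matI[of _ _ "mat_adjoint W" W n]) (use A W H WW WW' in \<open>auto simp: H_def\<close>)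
  then have "char_poly H = char_poly A" by (rule char_poly_similar)
  moreover have "char_poly H = char_poly A1 * char_poly K"
    unfolding HK by (rule char_poly_four_block_zeros_col[OF A1 _ K]) auto
  moreover have "char_poly A1 = [: -e, 1 :]"
    by (simp add: A1_def char_poly_defs det_def sign_def)
  ultimately have "char_poly K = (\<Prod>e \<leftarrow> es. [:- e, 1:])"
    using cp by (metis mult_cancel_left pCons_eq_0_iff zero_neq_one)
  from Cons.IH[OF Kh this] obtain V where V: "V \<in> carrier_mat m m"
    and VV: "mat_adjoint V * V = 1\<^sub>m m" and VK: "mat_adjoint V * K * V = mat_diag m (\<lambda>i. es ! i)"
    by blast
  \<comment> \<open>Bordering \<open>V\<close> by a single 1 leaves the entry \<open>e\<close> alone
    while \<open>V\<close> diagonalizes \<open>K\<close>; the product \<open>W * X\<close> is the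
    required unitary matrix.\<close>
  define X where "X = four_block_mat (1\<^sub>m 1) (0\<^sub>m 1 m) (0\<^sub>m m 1) V"
  have X: "X \<in> carrier_mat n n" using V by (auto simp: X_def n)
  have zadj: "mat_adjoint (0\<^sub>m a b :: complex mat) = 0\<^sub>m b a" for a b
    by (rule eq_matI) auto
  have Xa: "mat_adjoint X = four_block_mat (1\<^sub>m 1) (0\<^sub>m 1 m) (0\<^sub>m m 1) (mat_adjoint V)"
    using V unfolding X_def by (subst mat_adjoint_four_block[of _ 1 1 _ m _ m]) (auto simp: zadj)
  have Va: "mat_adjoint V \<in> carrier_mat m m" using V by simp
  have "mat_adjoint X * X = four_block_mat (1\<^sub>m 1) (0\<^sub>m 1 m) (0\<^sub>m m 1) (1\<^sub>m m)"
    unfolding Xa unfolding X_def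
    by (subst mult_four_block_mat[of _ 1 1 _ m _ m _ _ 1 _ m]) (use V VV in auto)
  then have XX: "mat_adjoint X * X = 1\<^sub>m n" unfolding n by simp
  have "mat_adjoint X * H = four_block_mat A1 (0\<^sub>m 1 m) (0\<^sub>m m 1) (mat_adjoint V * K)"
    unfolding Xa unfolding HK
    by (subst mult_four_block_mat[of _ 1 1 _ m _ m _ _ 1 _ m]) (use V K A1 in auto)
  then have "mat_adjoint X * H * X = four_block_mat A1 (0\<^sub>m 1 m) (0\<^sub>m m 1) (mat_diag m (\<lambda>i. es ! i))"
    unfolding X_def
    by (simp, subst mult_four_block_mat[of _ 1 1 _ m _ m _ _ 1 _ m]) (use V K A1 VK in auto)
  also have "\<dots> = mat_diag n (\<lambda>i. (e # es) ! i)"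
    by (rule eq_matI) (auto simp: mat_diag_def A1_def n nth_Cons')
  finally have XH: "mat_adjoint X * H * X = mat_diag n (\<lambda>i. (e # es) ! i)" .
  have "mat_adjoint (W * X) * (W * X) = mat_adjoint X * (mat_adjoint W * W) * X"
    using W X by (simp add: mat_adjoint_mult[of _ n n _ n] assoc
        mult_carrier_mat[of _ n n _ n] del: assoc_mult_mat)
  then have "mat_adjoint (W * X) * (W * X) = 1\<^sub>m n"
    using WW XX X by simp
  moreover have "mat_adjoint (W * X) * A * (W * X) = mat_adjoint X * H * X"
    using W X A by (simp add: H_def mat_adjoint_mult[of _ n n _ n] assoc
        mult_carrier_mat[of _ n n _ n] del: assoc_mult_mat)
  ultimately show ?case
    using XH W X by (intro bexI[of _ "W * X"]) auto
qed

section \<open>Factorization of \<open>T\<close> and simultaneous diagonalization of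
  \<open>T\<close> and \<open>M\<close>\<close>

lemma mat_diag_cong: "(\<And>i. i < n \<Longrightarrow> f i = g i) \<Longrightarrow> mat_diag n f = mat_diag n g"
  by (auto simp: mat_diag_def intro!: cong_mat)

lemma mat_diag_dims [simp]: "dim_row (mat_diag n f) = n" "dim_col (mat_diag n f) = n"
  by (simp_all add: mat_diag_def)

lemma row_mat_diag_scalar_prod [simp]:
  fixes x :: "complex vec"
  assumes "x \<in> carrier_vec n" "i < n"
  shows "row (mat_diag n f) i \<bullet> x = f i * x $ i"
proof -
  have "row (mat_diag n f) i \<bullet> x = (\<Sum>j<n. (if i = j then f j else 0) * x $ j)"
    using assms by (simp add: mat_diag_def scalar_prod_def atLeast0LessThan)
  also have "\<dots> = (\<Sum>j<n. if i = j then f i * x $ i else 0)"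
    by (rule sum.cong) auto
  finally show ?thesis using assms by simp
qed

text \<open>Moving \<open>A\<close> across the inner product shows that the form equals its own
  conjugate.\<close>

lemma hermitian_form_real:
  assumes "hermitian_mat n A" "x \<in> carrier_vec n"
  shows "Im ((A *\<^sub>v x) \<bullet>c x) = 0"
proof -
  from assms have A: "A \<in> carrier_mat n n" "mat_adjoint A = A" by (auto simp: hermitian_mat_def)
  have "(A *\<^sub>v x) \<bullet>c x = x \<bullet>c (A *\<^sub>v x)"
    using mat_mult_cscalar_prod_adjoint[OF A(1) assms(2) assms(2)] A(2) by simp
  also have "\<dots> = cnj ((A *\<^sub>v x) \<bullet>c x)"
    using A(1) assms(2) by (simp add: scalar_prod_def mult.commute)
  finally show ?thesis by (simp add: complex_eq_iff)
qed

text \<open>With \<open>T = U diag(p) U*\<close> and all \<open>p i\<close> positive,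
  \<open>C\<close> is \<open>U\<close> times the square root of the diagonal, and \<open>D\<close>
  is its explicit inverse.\<close>

lemma pos_def_factorization:
  assumes T: "pos_def_mat n T"
  shows "\<exists>C D. C \<in> carrier_mat n n \<and> D \<in> carrier_mat n n \<and> C * D = 1\<^sub>m n \<and> D * C = 1\<^sub>m n
    \<and> T = C * mat_adjoint C"
proof -
  from T have Th: "hermitian_mat n T" and Tc: "T \<in> carrier_mat n n"
    and pos: "\<And>x. x \<in> carrier_vec n \<Longrightarrow> x \<noteq> 0\<^sub>v n \<Longrightarrow> 0 < Re ((T *\<^sub>v x) \<bullet>c x)"
    by (auto simp: pos_def_mat_def hermitian_mat_def)
  obtain es where es: "char_poly T = (\<Prod>e\<leftarrow>es. [:- e, 1:])"
    using char_poly_factorized[OF Tc] by blast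
  from hermitian_diagonalization[OF Th es] obtain U where U: "U \<in> carrier_mat n n"
    and UU: "mat_adjoint U * U = 1\<^sub>m n" and UT: "mat_adjoint U * T * U = mat_diag n (\<lambda>i. es ! i)"
    by blast
  have Ua: "mat_adjoint U \<in> carrier_mat n n" using U by simp
  have UU': "U * mat_adjoint U = 1\<^sub>m n"
    by (rule mat_mult_left_right_inverse[OF Ua U UU])
  note assoc = assoc_mult_mat[of _ n n _ n _ n] mult_carrier_mat[of _ n n _ n]
  define p where "p i = Re (es ! i)" for i
  \<comment> \<open>The eigenvalue \<open>es ! i\<close> is the quadratic form of \<open>T\<close>
    at column \<open>i\<close> of \<open>U\<close>, hence real and positive.\<close>
  have p: "p i > 0 \<and> es ! i = complex_of_real (p i)" if i: "i < n" for i
  proof -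
    let ?c = "col U i"
    have c: "?c \<in> carrier_vec n" using U by auto
    have "?c \<noteq> 0\<^sub>v n"
    proof
      assume "?c = 0\<^sub>v n"
      then have "(mat_adjoint U * U) $$ (i, i) = 0" using U i by simp
      then show False using i by (simp add: UU)
    qed
    then have "0 < Re ((T *\<^sub>v ?c) \<bullet>c ?c)" using pos c by blast
    moreover have "es ! i = (T *\<^sub>v ?c) \<bullet>c ?c"
    proof -
      have "es ! i = (mat_adjoint U * (T * U)) $$ (i, i)"
        using UT U Ua Tc i by (simp add: assoc mat_diag_def)
      also have "\<dots> = conjugate ?c \<bullet> (T *\<^sub>v ?c)"
        unfolding col_mult2[OF Tc U i, symmetric]
        using U Ua Tc i by (subst index_mult_mat) simp_all
      also have "\<dots> = (T *\<^sub>v ?c) \<bullet>c ?c"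
        using c Tc by (intro comm_scalar_prod[of _ n]) auto
      finally show ?thesis .
    qed
    ultimately show ?thesis
      using hermitian_form_real[OF Th c] by (simp add: p_def complex_eq_iff)
  qed
  define R where "R = mat_diag n (\<lambda>i. complex_of_real (sqrt (p i)))"
  define S where "S = mat_diag n (\<lambda>i. complex_of_real (1 / sqrt (p i)))"
  have RS: "R \<in> carrier_mat n n" "S \<in> carrier_mat n n" by (simp_all add: R_def S_def)
  have "R * S = mat_diag n (\<lambda>i. 1)" "S * R = mat_diag n (\<lambda>i. 1)"
    unfolding R_def S_def mat_diag_diag using p
    by (intro mat_diag_cong; force simp flip: of_real_mult)+
  then have inv: "R * S = 1\<^sub>m n" "S * R = 1\<^sub>m n" by simp_all
  have Ra: "mat_adjoint R = R" by (simp add: R_def mat_adjoint_mat_diag)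
  have RR: "R * R = mat_adjoint U * T * U"
    unfolding R_def mat_diag_diag UT using p
    by (intro mat_diag_cong) (auto simp: less_imp_le simp flip: of_real_mult)
  define C where "C = U * R"
  define D where "D = S * mat_adjoint U"
  have CD: "C \<in> carrier_mat n n" "D \<in> carrier_mat n n" using U RS by (auto simp: C_def D_def)
  have "C * D = U * (R * S) * mat_adjoint U"
    using U Ua RS by (simp add: C_def D_def assoc del: assoc_mult_mat)
  then have 1: "C * D = 1\<^sub>m n" using U Ua by (simp add: inv UU')
  have 2: "D * C = 1\<^sub>m n" by (rule mat_mult_left_right_inverse[OF CD 1])
  have "C * mat_adjoint C = U * (R * R) * mat_adjoint U"
    using U Ua RS by (simp add: C_def mat_adjoint_mult[of _ n n _ n] Ra assoc del: assoc_mult_mat)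
  also have "\<dots> = (U * mat_adjoint U) * T * (U * mat_adjoint U)"
    unfolding RR using U Ua Tc by (simp add: assoc del: assoc_mult_mat)
  also have "\<dots> = T" using Tc by (simp add: UU')
  finally show ?thesis using CD 1 2 by auto
qed

text \<open>With \<open>T = C C*\<close>, the product \<open>T * M\<close> is similar through
  \<open>C\<close> to the Hermitian matrix \<open>H = C* M C\<close>. If the unitary
  \<open>U\<close> diagonalizes \<open>H\<close>, then \<open>P = C U\<close> diagonalizes
  \<open>M\<close> by congruence, and \<open>P P*\<close> is still \<open>T\<close> because
  \<open>U\<close> cancels.\<close>

theorem simultaneous_diagonalization:
  assumes T: "pos_def_mat n T" and M: "hermitian_mat n M"
    and cp: "char_poly (T * M) = (\<Prod>e\<leftarrow>es. [:- e, 1:])"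
  shows "\<exists>P Q. P \<in> carrier_mat n n \<and> Q \<in> carrier_mat n n \<and> P * Q = 1\<^sub>m n \<and> Q * P = 1\<^sub>m n
    \<and> T = P * mat_adjoint P \<and> mat_adjoint P * M * P = mat_diag n (\<lambda>i. es ! i)"
proof -
  note assoc = assoc_mult_mat[of _ n n _ n _ n] mult_carrier_mat[of _ n n _ n]
  from pos_def_factorization[OF T] obtain C D where C: "C \<in> carrier_mat n n" and D: "D \<in> carrier_mat n n"
    and CD: "C * D = 1\<^sub>m n" and DC: "D * C = 1\<^sub>m n" and TC: "T = C * mat_adjoint C" by blast
  from M have Mc: "M \<in> carrier_mat n n" and Mh: "mat_adjoint M = M" by (auto simp: hermitian_mat_def)
  have Ca: "mat_adjoint C \<in> carrier_mat n n" using C by simp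
  define H where "H = mat_adjoint C * M * C"
  have H: "H \<in> carrier_mat n n" using C Mc by (auto simp: H_def)
  have Hh: "hermitian_mat n H"
    using C Mc H Mh by (auto simp: H_def hermitian_mat_def mat_adjoint_mult[of _ n n _ n] assoc
      simp del: assoc_mult_mat)
  have "C * H * D = C * mat_adjoint C * M * (C * D)"
    using C Ca D Mc by (simp add: H_def assoc del: assoc_mult_mat)
  then have "T * M = C * H * D" using C Ca Mc
    by (simp add: CD TC assoc del: assoc_mult_mat)
  then have "similar_mat (T * M) H"
    by (intro similar_matI[of _ _ C D n]) (use C D H CD DC Mc Ca TC in \<open>auto simp del: assoc_mult_mat\<close>)
  then have "char_poly H = (\<Prod>e\<leftarrow>es. [:- e, 1:])" using char_poly_similar cp by metis
  from hermitian_diagonalization[OF Hh this] obtain U where U: "U \<in> carrier_mat n n"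
    and UU: "mat_adjoint U * U = 1\<^sub>m n" and UH: "mat_adjoint U * H * U = mat_diag n (\<lambda>i. es ! i)"
    by blast
  have Ua: "mat_adjoint U \<in> carrier_mat n n" using U by simp
  have UU': "U * mat_adjoint U = 1\<^sub>m n"
    by (rule mat_mult_left_right_inverse[OF Ua U UU])
  define P where "P = C * U"
  define Q where "Q = mat_adjoint U * D"
  have P: "P \<in> carrier_mat n n" and Q: "Q \<in> carrier_mat n n" using C D U by (auto simp: P_def Q_def)
  have "P * Q = C * (U * mat_adjoint U) * D"
    using C D U Ua by (simp add: P_def Q_def assoc del: assoc_mult_mat)
  then have PQ: "P * Q = 1\<^sub>m n" using C D by (simp add: UU' CD)
  have QP: "Q * P = 1\<^sub>m n" by (rule mat_mult_left_right_inverse[OF P Q PQ])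
  have "P * mat_adjoint P = C * (U * mat_adjoint U) * mat_adjoint C"
    using C U Ca Ua by (simp add: P_def mat_adjoint_mult[of _ n n _ n] assoc del: assoc_mult_mat)
  then have "T = P * mat_adjoint P" using C Ca by (simp add: UU' TC)
  moreover have "mat_adjoint P * M * P = mat_adjoint U * H * U"
    using C U Ca Ua Mc by (simp add: P_def H_def mat_adjoint_mult[of _ n n _ n] assoc del: assoc_mult_mat)
  ultimately show ?thesis using P Q PQ QP UH by auto
qed

text \<open>Moving the left factor \<open>P\<close> across the inner product turns the
  \<open>T\<close>-norm into a Euclidean norm.\<close>

lemma normT_factorization:
  assumes P: "P \<in> carrier_mat n n" and x: "x \<in> carrier_vec n"
  shows "normT (P * mat_adjoint P) x = sqrt (\<Sum>j<n. (cmod ((mat_adjoint P *\<^sub>v x) $ j))\<^sup>2)"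
proof -
  have Pa: "mat_adjoint P \<in> carrier_mat n n" using P by simp
  have "((P * mat_adjoint P) *\<^sub>v x) \<bullet>c x = (mat_adjoint P *\<^sub>v x) \<bullet>c (mat_adjoint P *\<^sub>v x)"
    using P Pa x mat_mult_cscalar_prod_adjoint[OF P mult_mat_vec_carrier[OF Pa x] x]
    by (simp add: assoc_mult_mat_vec[of _ n n _ n])
  then show ?thesis
    using P by (simp add: normT_def cscalar_prod_self del: of_real_sum)
qed

section \<open>The convergence factor and the quadratic that attains it\<close>

text \<open>The two branches are one expression in the longer interval length \<open>g\<close>: in
  the first \<open>mn = mqp + g\<close>, in the second \<open>m1 = mqm - g\<close>.\<close>

lemma kappa_tilde_eq:
  assumes "mqm < 0" "0 < mqp" "m1 \<le> mqm" "mqp \<le> mn"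
  defines "g \<equiv> max (mqm - m1) (mn - mqp)"
  shows "kappa_tilde m1 mqm mqp mn = (g - mqm) * (g + mqp) / (- mqm * mqp)"
  using assms by (auto simp: kappa_tilde_def g_def max_def field_simps)

text \<open>The closed form does not decrease as \<open>g\<close> grows from 0, where its value is
  1; hence \<open>k\<close> is at least 1.\<close>

lemma kappa_tilde_rate:
  assumes "mqm < 0" "0 < mqp" "m1 \<le> mqm" "mqp \<le> mn"
  defines "k \<equiv> kappa_tilde m1 mqm mqp mn"
  shows "0 \<le> (k - 1) / (k + 1)" "(k - 1) / (k + 1) < 1"
proof -
  define g where "g = max (mqm - m1) (mn - mqp)"
  have g: "g \<ge> 0" using assms by (auto simp: g_def)
  have "(- mqm) * mqp \<le> (g - mqm) * (g + mqp)"
    using assms g by (intro mult_mono) auto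
  moreover have "0 < (- mqm) * mqp" using assms by (simp add: mult_neg_pos)
  ultimately have "k \<ge> 1" unfolding k_def
    using kappa_tilde_eq[OF assms(1-4)] by (simp add: g_def le_divide_eq del: mult_minus_left)
  then show "0 \<le> (k - 1) / (k + 1)" "(k - 1) / (k + 1) < 1" by auto
qed

text \<open>With \<open>g\<close> the longer of the two interval lengths, both intervals are enlarged to length \<open>g\<close>;
  then \<open>z (z - mqp - mqm)\<close> maps each of them onto the same interval, whose end points have ratio
  \<open>kappa_tilde\<close>, and the polynomial of one Richardson step is used.\<close>

lemma kappa_tilde_polynomial:
  assumes "mqm < 0" "0 < mqp" "m1 \<le> mqm" "mqp \<le> mn"
  defines "k \<equiv> kappa_tilde m1 mqm mqp mn"
  shows "\<exists>a b. \<forall>z. z \<in> {m1..mqm} \<union> {mqp..mn} \<longrightarrow> \<bar>1 - a * z - b * z\<^sup>2\<bar> \<le> (k - 1) / (k + 1)"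
proof -
  define g where "g = max (mqm - m1) (mn - mqp)"
  have g: "g \<ge> 0" "mqm - g \<le> m1" "mn \<le> mqp + g" using assms by (auto simp: g_def)
  \<comment> \<open>With \<open>f z = z * (z - mqp - mqm)\<close>, \<open>lo\<close> is the value of
    \<open>f\<close> at the inner end points \<open>mqm\<close> and \<open>mqp\<close>, and
    \<open>hi\<close> its value at the outer ones, \<open>mqm - g\<close> and
    \<open>mqp + g\<close>.\<close>
  define lo where "lo = - mqm * mqp"
  define hi where "hi = (g - mqm) * (g + mqp)"
  have lo: "lo > 0" using assms by (simp add: lo_def mult_neg_pos)
  have k: "k = hi / lo" unfolding k_def hi_def lo_def g_def by (rule kappa_tilde_eq[OF assms(1-4)])
  have hl: "hi - lo = g * (g + mqp - mqm)" by (simp add: hi_def lo_def algebra_simps)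
  then have "lo \<le> hi" using g assms by (smt (verit) mult_nonneg_nonneg)
  have rate: "(k - 1) / (k + 1) = (hi - lo) / (hi + lo)"
  proof -
    have "k - 1 = (hi - lo) / lo" "k + 1 = (hi + lo) / lo" using lo by (simp_all add: k field_simps)
    then show ?thesis using lo by simp
  qed
  have "\<bar>1 - (- 2 * (mqp + mqm) / (lo + hi)) * z - (2 / (lo + hi)) * z\<^sup>2\<bar> \<le> (k - 1) / (k + 1)"
    if z: "z \<in> {m1..mqm} \<union> {mqp..mn}" for z
  proof -
    \<comment> \<open>The point \<open>z\<close> lies outside the open gap between
      \<open>mqm\<close> and \<open>mqp\<close> but inside the enlarged hull. The two products
      expand to \<open>f z - lo\<close> and \<open>f z - hi\<close>.\<close>
    have "0 \<le> (z - mqp) * (z - mqm)"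
      using z assms by (auto intro: mult_nonneg_nonneg mult_nonpos_nonpos)
    moreover have "(z - mqp - g) * (z - mqm + g) \<le> 0"
      using z assms g by (auto intro!: mult_nonpos_nonneg)
    ultimately have q: "lo \<le> z\<^sup>2 - (mqp + mqm) * z" "z\<^sup>2 - (mqp + mqm) * z \<le> hi"
      by (simp_all add: lo_def hi_def algebra_simps power2_eq_square)
    have "1 - (- 2 * (mqp + mqm) / (lo + hi)) * z - (2 / (lo + hi)) * z\<^sup>2
        = (lo + hi - 2 * (z\<^sup>2 - (mqp + mqm) * z)) / (hi + lo)"
    proof -
      have "1 - (- 2 * c / s) * z - (2 / s) * w = (s - 2 * (w - c * z)) / s" if "s \<noteq> 0" for s c w :: real
        using that by (simp add: field_simps)
      from this[of "lo + hi" "mqp + mqm" "z\<^sup>2"] show ?thesis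
        using lo \<open>lo \<le> hi\<close> unfolding add.commute[of hi lo] by linarith
    qed
    moreover have "\<bar>lo + hi - 2 * (z\<^sup>2 - (mqp + mqm) * z)\<bar> \<le> hi - lo"
    proof -
      have "\<bar>lo + hi - 2 * w\<bar> \<le> hi - lo" if "lo \<le> w" "w \<le> hi" for w using that by linarith
      then show ?thesis using q by blast
    qed
    ultimately show ?thesis
      unfolding rate using lo \<open>lo \<le> hi\<close> by (simp add: divide_right_mono)
  qed
  then show ?thesis by blast
qed

section \<open>Hermitian pencils and the convergence of the iteration\<close>

lemma mat_mult_vec_uminus:
  fixes A :: "complex mat"
  assumes "A \<in> carrier_mat n m" "x \<in> carrier_vec m"
  shows "A *\<^sub>v (- x) = - (A *\<^sub>v x)"
  using assms by (intro eq_vecI) auto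

text \<open>Since \<open>l\<close> is only given as a complex number, its reality has to be derived:
  pairing \<open>A x = l B x\<close> with \<open>x\<close> writes a real number as \<open>l\<close>
  times a positive one.\<close>

lemma hermitian_pencil:
  assumes A: "hermitian_mat n A" and B: "pos_def_mat n B"
    and x: "x \<in> carrier_vec n" "x \<noteq> 0\<^sub>v n" and ev: "(A - l \<cdot>\<^sub>m B) *\<^sub>v x = 0\<^sub>v n"
  shows "hermitian_mat n (A - l \<cdot>\<^sub>m B)"
proof -
  have Bh: "hermitian_mat n B" and pos: "0 < Re ((B *\<^sub>v x) \<bullet>c x)"
    using B x by (auto simp: pos_def_mat_def)
  have Ac: "A \<in> carrier_mat n n" "mat_adjoint A = A" and Bc: "B \<in> carrier_mat n n" "mat_adjoint B = B"
    using A Bh by (auto simp: hermitian_mat_def)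
  have lBx: "(l \<cdot>\<^sub>m B) *\<^sub>v x = l \<cdot>\<^sub>v (B *\<^sub>v x)"
    using Bc x by (intro eq_vecI) auto
  have "A *\<^sub>v x - l \<cdot>\<^sub>v (B *\<^sub>v x) = 0\<^sub>v n"
    using ev Ac Bc x by (simp add: minus_mult_distrib_mat_vec[of _ n n] lBx)
  then have "A *\<^sub>v x = l \<cdot>\<^sub>v (B *\<^sub>v x)"
    using Ac Bc x by (intro eq_vecI) (auto dest!: arg_cong[where f = "\<lambda>y. y $ _"] simp: vec_eq_iff)
  then have "(A *\<^sub>v x) \<bullet>c x = l * ((B *\<^sub>v x) \<bullet>c x)"
    using Bc x by simp
  moreover have "Im ((A *\<^sub>v x) \<bullet>c x) = 0" "Im ((B *\<^sub>v x) \<bullet>c x) = 0"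
    using hermitian_form_real A Bh x by blast+
  ultimately have "Im l = 0" using pos by simp
  then have l: "cnj l = l" by (simp add: complex_eq_iff)
  have "cnj (A $$ (j, i)) = A $$ (i, j) \<and> cnj (B $$ (j, i)) = B $$ (i, j)" if "i < n" "j < n" for i j
    using that Ac Bc mat_adjoint_index[of i A j] mat_adjoint_index[of i B j] by auto
  then show ?thesis
    unfolding hermitian_mat_def using Ac(1) Bc(1) l by (auto intro!: eq_matI)
qed

theorem theorem2p1:
  fixes n q :: nat and A B T :: "complex mat" and lq :: complex
    and mu :: "real list"
    and v r :: "nat \<Rightarrow> complex vec" and \<alpha> \<beta> :: "nat \<Rightarrow> complex"
    and x0 y0 :: "complex vec"
  defines "M \<equiv> A - lq \<cdot>\<^sub>m B"
  assumes A: "hermitian_mat n A"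
    and B: "pos_def_mat n B"
    and simple: "simple_pencil_eigenvalue A B lq"
    and T: "pos_def_mat n T"
    and r_def: "\<And>i. r i = (lq \<cdot>\<^sub>m B - A) *\<^sub>v v i"
    and v_carrier: "v 0 \<in> carrier_vec n"
    and iter: "\<And>i. v (Suc i) = v i + \<alpha> i \<cdot>\<^sub>v (T *\<^sub>v r i) + \<beta> i \<cdot>\<^sub>v (T * M * T *\<^sub>v r i)"
    and minres: "\<And>i a b. normT T (r (Suc i))
        \<le> normT T (r i - M *\<^sub>v (a \<cdot>\<^sub>v (T *\<^sub>v r i) + b \<cdot>\<^sub>v (T * M * T *\<^sub>v r i)))"
    and mu_len: "length mu = n"
    and mu_sorted: "sorted mu"
    and mu_eig: "char_poly (T * M) = (\<Prod>m\<leftarrow>mu. [: - complex_of_real m, 1 :])"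
    and q: "2 \<le> q" "q \<le> n - 1"
    and mu_q: "mu ! (q - 2) < 0" "mu ! (q - 1) = 0" "0 < mu ! q"
    and decomp: "v 0 = x0 + y0" "x0 \<in> mat_kernel M"
      "y0 \<in> {T * M *\<^sub>v z | z. z \<in> carrier_vec n}"
    and x0_nz: "x0 \<noteq> 0\<^sub>v n"
  shows "(\<exists>w \<in> mat_kernel M. w \<noteq> 0\<^sub>v n \<and> (\<forall>j < n. (\<lambda>i. v i $ j) \<longlonglongrightarrow> w $ j))
    \<and> (\<forall>i. normT T (r (Suc i)) / normT T (r i)
          \<le> (kappa_tilde (mu ! 0) (mu ! (q - 2)) (mu ! q) (mu ! (n - 1)) - 1)
             / (kappa_tilde (mu ! 0) (mu ! (q - 2)) (mu ! q) (mu ! (n - 1)) + 1)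
        \<and> (kappa_tilde (mu ! 0) (mu ! (q - 2)) (mu ! q) (mu ! (n - 1)) - 1)
             / (kappa_tilde (mu ! 0) (mu ! (q - 2)) (mu ! q) (mu ! (n - 1)) + 1) < 1)"
proof -
  note assoc = assoc_mult_mat[of _ n n _ n _ n] mult_carrier_mat[of _ n n _ n]
    assoc_mult_mat_vec[of _ n n _ n]
  define \<rho> where "\<rho> = (kappa_tilde (mu ! 0) (mu ! (q - 2)) (mu ! q) (mu ! (n - 1)) - 1)
             / (kappa_tilde (mu ! 0) (mu ! (q - 2)) (mu ! q) (mu ! (n - 1)) + 1)"
  have Ac: "A \<in> carrier_mat n n" and Bc: "B \<in> carrier_mat n n" and Tc: "T \<in> carrier_mat n n"
    using A B T by (auto simp: hermitian_mat_def pos_def_mat_def)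
  have Mc: "M \<in> carrier_mat n n" using Ac Bc unfolding M_def by auto
  have x0: "x0 \<in> carrier_vec n" "M *\<^sub>v x0 = 0\<^sub>v n"
    using mat_kernelD[OF Mc decomp(2)] by auto
  \<comment> \<open>The nonzero kernel vector \<open>x0\<close> serves as the eigenvector that makes
    \<open>lq\<close> real.\<close>
  have Mh: "hermitian_mat n M"
    unfolding M_def using hermitian_pencil[OF A B x0(1) x0_nz] x0(2) unfolding M_def by blast
  have "char_poly (T * M) = (\<Prod>e\<leftarrow>map complex_of_real mu. [:- e, 1:])"
    using mu_eig by (simp add: o_def)
  from simultaneous_diagonalization[OF T Mh this] obtain P Q
    where P: "P \<in> carrier_mat n n" and Q: "Q \<in> carrier_mat n n"
      and PQ: "P * Q = 1\<^sub>m n" and QP: "Q * P = 1\<^sub>m n" and TP: "T = P * mat_adjoint P"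
      and diag: "mat_adjoint P * M * P = mat_diag n (\<lambda>i. map complex_of_real mu ! i)" by blast
  define D where "D = mat_diag n (\<lambda>i. complex_of_real (mu ! i))"
  have D: "D \<in> carrier_mat n n" by (simp add: D_def)
  have PMP: "mat_adjoint P * M * P = D"
    unfolding diag D_def by (rule mat_diag_cong) (simp add: mu_len)
  have Pa: "mat_adjoint P \<in> carrier_mat n n" using P by simp
  have PQv: "P *\<^sub>v (Q *\<^sub>v x) = x" "Q *\<^sub>v (P *\<^sub>v x) = x" if "x \<in> carrier_vec n" for x
    using that P Q PQ QP by (metis assoc_mult_mat_vec one_mult_mat_vec)+
  have PMPv: "mat_adjoint P *\<^sub>v (M *\<^sub>v (P *\<^sub>v x)) = D *\<^sub>v x" if "x \<in> carrier_vec n" for x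
    using that P Pa Mc unfolding PMP[symmetric] by (simp add: assoc del: assoc_mult_mat)
  have Tv: "T *\<^sub>v x = P *\<^sub>v (mat_adjoint P *\<^sub>v x)" if "x \<in> carrier_vec n" for x
    using that P Pa by (simp add: TP assoc)
  have rM: "r i = - (M *\<^sub>v v i)" and vc: "v i \<in> carrier_vec n" for i
  proof -
    \<comment> \<open>This form of \<open>r i\<close> presupposes the dimension of
      \<open>v i\<close>, whose induction in turn uses it at the same index; so it is proved
      conditionally first.\<close>
    have rc: "r i = - (M *\<^sub>v v i)" if "v i \<in> carrier_vec n" for i
    proof -
      have "lq \<cdot>\<^sub>m B - A = - M" using Ac Bc by (intro eq_matI) (auto simp: M_def)
      then show ?thesis using r_def that Mc by simp
    qed
    show vc: "v i \<in> carrier_vec n" for i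
    proof (induction i)
      case (Suc i)
      then have "r i \<in> carrier_vec n" using rc Mc by simp
      then show ?case
        unfolding iter using Suc Tc Mc
        by (intro add_carrier_vec smult_carrier_vec[THEN iffD2] mult_mat_vec_carrier mult_carrier_mat)
    qed (rule v_carrier)
    show "r i = - (M *\<^sub>v v i)" by (rule rc[OF vc])
  qed
  have rc: "r i \<in> carrier_vec n" for i using rM vc Mc by simp
  define u where "u i = Q *\<^sub>v v i" for i
  define s where "s i = mat_adjoint P *\<^sub>v r i" for i
  have uc: "u i \<in> carrier_vec n" and sc: "s i \<in> carrier_vec n" for i
    using vc rc Q Pa by (simp_all add: u_def s_def)
  have vu: "v i = P *\<^sub>v u i" for i using PQv vc by (simp add: u_def)
  have Tr: "T *\<^sub>v r i = P *\<^sub>v s i" for i using Tv rc by (simp add: s_def)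
  have TMTr: "T * M * T *\<^sub>v r i = P *\<^sub>v (D *\<^sub>v s i)" for i
  proof -
    have "T * M * T *\<^sub>v r i = T *\<^sub>v (M *\<^sub>v (P *\<^sub>v s i))"
      using Tc Mc rc by (simp add: assoc Tr del: assoc_mult_mat)
    also have "\<dots> = P *\<^sub>v (D *\<^sub>v s i)"
      using Mc P sc by (simp add: Tv PMPv)
    finally show ?thesis .
  qed
  have s_index: "s i $ j = - complex_of_real (mu ! j) * u i $ j" if "j < n" for i j
  proof -
    have "s i = - (D *\<^sub>v u i)"
      using Pa Mc P uc PMPv[OF uc, of i]
      by (simp add: s_def rM vu mat_mult_vec_uminus[OF Pa])
    then show ?thesis using that uc D by (simp add: D_def)
  qed
  have u_iter: "u (Suc i) $ j = u i $ j + (\<alpha> i + \<beta> i * complex_of_real (mu ! j)) * s i $ j"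
    if "j < n" for i j
  proof -
    have "P *\<^sub>v u (Suc i) = P *\<^sub>v (u i + \<alpha> i \<cdot>\<^sub>v s i + \<beta> i \<cdot>\<^sub>v (D *\<^sub>v s i))"
      using iter[of i] P uc sc D unfolding Tr TMTr
      by (simp add: vu[symmetric] mult_add_distrib_mat_vec[of _ n n] mult_mat_vec[of _ n n])
    then have "u (Suc i) = u i + \<alpha> i \<cdot>\<^sub>v s i + \<beta> i \<cdot>\<^sub>v (D *\<^sub>v s i)"
      using PQv(2) uc sc D by (metis add_carrier_vec mult_mat_vec_carrier smult_carrier_vec)
    then show ?thesis using that uc[of i] sc[of i] D by (simp add: D_def algebra_simps)
  qed
  \<comment> \<open>Lists count from 0: the zero eigenvalue sits at index \<open>q - 1\<close>, its
    neighbours at \<open>q - 2\<close> and \<open>q\<close>.\<close>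
  have mu_range: "mu ! j \<in> {mu ! 0..mu ! (q - 2)} \<union> {mu ! q..mu ! (n - 1)}" if "j < n" "j \<noteq> q - 1" for j
  proof (cases "j < q - 1")
    case True
    then have "j \<le> q - 2" by simp
    then show ?thesis using sorted_nth_mono[OF mu_sorted] that q mu_len by (auto simp: sorted_nth_mono)
  next
    case False
    then have "q \<le> j" "j \<le> n - 1" using that by auto
    then show ?thesis using sorted_nth_mono[OF mu_sorted] that q mu_len by (auto simp: sorted_nth_mono)
  qed
  have mu_ord: "mu ! 0 \<le> mu ! (q - 2)" "mu ! q \<le> mu ! (n - 1)"
    using sorted_nth_mono[OF mu_sorted] q mu_len by auto
  note rate = kappa_tilde_rate[OF mu_q(1,3) mu_ord, folded \<rho>_def]
  obtain a b where ab: "\<And>z. z \<in> {mu ! 0..mu ! (q - 2)} \<union> {mu ! q..mu ! (n - 1)} \<Longrightarrow>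
      \<bar>1 - a * z - b * z\<^sup>2\<bar> \<le> \<rho>"
    using kappa_tilde_polynomial[OF mu_q(1,3) mu_ord, folded \<rho>_def] by blast
  have norm_eq: "normT T x = sqrt (\<Sum>j<n. (cmod ((mat_adjoint P *\<^sub>v x) $ j))\<^sup>2)"
    if "x \<in> carrier_vec n" for x
    unfolding TP using normT_factorization[OF P that] .
  have step: "normT T (r (Suc i)) \<le> \<rho> * normT T (r i)" for i
  proof -
    \<comment> \<open>The minimal residual is compared with the one produced by the fixed
      coefficients of the quadratic on the two spectral intervals.\<close>
    define a' b' where "a' = complex_of_real a" and "b' = complex_of_real b"
    define w where "w = r i - M *\<^sub>v (a' \<cdot>\<^sub>v (T *\<^sub>v r i) + b' \<cdot>\<^sub>v (T * M * T *\<^sub>v r i))"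
    have wc: "w \<in> carrier_vec n" unfolding w_def Tr TMTr using rc Mc P sc D by simp
    have "w = r i - M *\<^sub>v (P *\<^sub>v (a' \<cdot>\<^sub>v s i + b' \<cdot>\<^sub>v (D *\<^sub>v s i)))"
      unfolding w_def Tr TMTr using P sc D
      by (simp add: mult_add_distrib_mat_vec[of _ n n] mult_mat_vec[of _ n n])
    then have "mat_adjoint P *\<^sub>v w = s i - D *\<^sub>v (a' \<cdot>\<^sub>v s i + b' \<cdot>\<^sub>v (D *\<^sub>v s i))"
      using Pa Mc P rc sc D
      by (simp add: mat_mult_vec_minus[OF Pa] PMPv s_def[symmetric])
    moreover have "a' \<cdot>\<^sub>v s i + b' \<cdot>\<^sub>v (D *\<^sub>v s i) \<in> carrier_vec n"
      using sc D by simp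
    ultimately have Pw: "(mat_adjoint P *\<^sub>v w) $ j
        = complex_of_real (1 - a * mu ! j - b * (mu ! j)\<^sup>2) * s i $ j" if "j < n" for j
      using that sc[of i] D
      by (simp add: D_def a'_def b'_def algebra_simps power2_eq_square)
    have "(\<Sum>j<n. (cmod ((mat_adjoint P *\<^sub>v w) $ j))\<^sup>2) \<le> (\<Sum>j<n. \<rho>\<^sup>2 * (cmod (s i $ j))\<^sup>2)"
    proof (rule sum_mono)
      fix j assume "j \<in> {..<n}"
      then have j: "j < n" by simp
      have "cmod ((mat_adjoint P *\<^sub>v w) $ j) \<le> \<rho> * cmod (s i $ j)"
      \<comment> \<open>At the zero eigenvalue the quadratic equals 1 and gives no reduction, but
        there the residual component itself vanishes.\<close>
      proof (cases "j = q - 1")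
        case True
        then have "s i $ j = 0" using s_index[OF j] mu_q by simp
        then show ?thesis using Pw[OF j] by simp
      next
        case False
        show ?thesis unfolding Pw[OF j] norm_mult norm_of_real
          by (intro mult_right_mono ab mu_range j False) simp
      qed
      then have "(cmod ((mat_adjoint P *\<^sub>v w) $ j))\<^sup>2 \<le> (\<rho> * cmod (s i $ j))\<^sup>2"
        by (intro power_mono) auto
      then show "(cmod ((mat_adjoint P *\<^sub>v w) $ j))\<^sup>2 \<le> \<rho>\<^sup>2 * (cmod (s i $ j))\<^sup>2"
        by (simp add: power_mult_distrib)
    qed
    then have "normT T w \<le> sqrt (\<rho>\<^sup>2 * (\<Sum>j<n. (cmod (s i $ j))\<^sup>2))"
      unfolding norm_eq[OF wc] by (simp add: sum_distrib_left)
    also have "\<dots> = \<rho> * normT T (r i)"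
      using rate by (simp add: norm_eq[OF rc] s_def real_sqrt_mult)
    finally show ?thesis using minres[of i a' b'] unfolding w_def by linarith
  qed
  have norm_nonneg: "0 \<le> normT T (r i)" for i
    unfolding norm_eq[OF rc] by (simp add: sum_nonneg)
  \<comment> \<open>If the residual is already zero, the quotient is 0 by the convention for
    division by zero, and \<open>\<rho>\<close> is nonnegative.\<close>
  have ratio: "normT T (r (Suc i)) / normT T (r i) \<le> \<rho>" for i
    using step[of i] norm_nonneg[of i] rate
    by (cases "normT T (r i) = 0") (auto simp: divide_le_eq mult.commute)
  have "normT T (r i) \<le> \<rho> ^ i * normT T (r 0)" for i
  proof (induction i)
    case (Suc i)
    have "normT T (r (Suc i)) \<le> \<rho> * normT T (r i)" by (rule step)
    also have "\<dots> \<le> \<rho> * (\<rho> ^ i * normT T (r 0))" using Suc rate by (intro mult_left_mono)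
    finally show ?case by simp
  qed simp
  moreover have "cmod (s i $ j) \<le> normT T (r i)" if "j < n" for i j
  proof -
    have "(cmod (s i $ j))\<^sup>2 \<le> (\<Sum>j<n. (cmod (s i $ j))\<^sup>2)"
      using that by (intro member_le_sum) auto
    then show ?thesis unfolding norm_eq[OF rc] s_def[symmetric] by (rule real_le_rsqrt)
  qed
  ultimately have s_le: "cmod (s i $ j) \<le> \<rho> ^ i * normT T (r 0)" if "j < n" for i j
    using that by (meson order_trans)
  have s_lim: "(\<lambda>i. s i $ j) \<longlonglongrightarrow> 0" if "j < n" for j
  proof (rule tendsto_norm_zero_cancel, rule tendsto_sandwich[OF _ _ tendsto_const])
    show "(\<lambda>i. \<rho> ^ i * normT T (r 0)) \<longlonglongrightarrow> 0"
      by (intro tendsto_mult_left_zero LIMSEQ_power_zero) (use rate in simp)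
  qed (use s_le[OF that] in auto)
  define k where "k = Q *\<^sub>v x0"
  have kc: "k \<in> carrier_vec n" and x0k: "x0 = P *\<^sub>v k" using x0 Q PQv by (simp_all add: k_def)
  have "mat_adjoint P *\<^sub>v 0\<^sub>v n = 0\<^sub>v n" using P by (intro eq_vecI) auto
  then have Dk: "D *\<^sub>v k = 0\<^sub>v n"
    using PMPv[OF kc] x0 unfolding x0k[symmetric] by simp
  \<comment> \<open>Lying in the kernel of \<open>M\<close>, \<open>x0\<close> has only the
    coordinate of the zero eigenvalue.\<close>
  have k0: "k $ j = 0" if "j < n" "mu ! j \<noteq> 0" for j
  proof -
    have "(D *\<^sub>v k) $ j = complex_of_real (mu ! j) * k $ j" using that kc by (simp add: D_def)
    then show ?thesis using that by (simp add: Dk)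
  qed
  \<comment> \<open>In coordinates a vector of the range of \<open>T * M\<close> is \<open>D\<close>
    applied to something, so \<open>y0\<close> contributes nothing at index
    \<open>q - 1\<close>.\<close>
  have u0: "u 0 $ (q - 1) = k $ (q - 1)"
  proof -
    from decomp(3) obtain z where z: "z \<in> carrier_vec n" and y0: "y0 = T * M *\<^sub>v z" by blast
    have Qz: "Q *\<^sub>v z \<in> carrier_vec n" using Q z by simp
    have "y0 = T *\<^sub>v (M *\<^sub>v (P *\<^sub>v (Q *\<^sub>v z)))" using z Tc Mc by (simp add: y0 assoc PQv)
    also have "\<dots> = P *\<^sub>v (D *\<^sub>v (Q *\<^sub>v z))"
      using Qz Mc P by (simp add: Tv PMPv)
    finally have "v 0 = P *\<^sub>v (k + D *\<^sub>v (Q *\<^sub>v z))"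
      using decomp(1) x0k kc Qz D P by (simp add: mult_add_distrib_mat_vec[of _ n n])
    then have "u 0 = k + D *\<^sub>v (Q *\<^sub>v z)" using kc Qz D PQv by (simp add: u_def)
    then show ?thesis using q mu_q kc Qz D by (simp add: D_def)
  qed
  \<comment> \<open>The update of this coordinate is a multiple of the residual component there,
    which is zero.\<close>
  have uq: "u i $ (q - 1) = k $ (q - 1)" for i
    by (induction i) (use u0 u_iter[of "q - 1"] s_index[of "q - 1"] q mu_q in auto)
  have u_lim: "(\<lambda>i. u i $ j) \<longlonglongrightarrow> k $ j" if j: "j < n" for j
  proof (cases "j = q - 1")
    case True
    show ?thesis unfolding True uq by (rule tendsto_const)
  next
    case False
    then have mu0: "mu ! j \<noteq> 0" using mu_range[OF j] mu_q by auto
    \<comment> \<open>Away from index \<open>q - 1\<close> the relation between \<open>s\<close> and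
      \<open>u\<close> can be divided by \<open>mu ! j\<close>, so \<open>u\<close> inherits the
      limit 0.\<close>
    have "(\<lambda>i. - (1 / complex_of_real (mu ! j)) * s i $ j) \<longlonglongrightarrow> 0"
      by (intro tendsto_mult_right_zero s_lim j)
    moreover have "- (1 / complex_of_real (mu ! j)) * s i $ j = u i $ j" for i
      using s_index[OF j] mu0 by simp
    ultimately show ?thesis using k0[OF j mu0] by simp
  qed
  have "(\<lambda>i. v i $ j) \<longlonglongrightarrow> x0 $ j" if j: "j < n" for j
  proof -
    have "(P *\<^sub>v x) $ j = (\<Sum>l<n. P $$ (j, l) * x $ l)" if "x \<in> carrier_vec n" for x
      using that j P by (simp add: scalar_prod_def atLeast0LessThan)
    then show ?thesis
      unfolding vu x0k using uc kc by (auto intro!: tendsto_intros u_lim)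
  qed
  then have "\<exists>w \<in> mat_kernel M. w \<noteq> 0\<^sub>v n \<and> (\<forall>j < n. (\<lambda>i. v i $ j) \<longlonglongrightarrow> w $ j)"
    using decomp(2) x0_nz by blast
  then show ?thesis using ratio rate(2) unfolding \<rho>_def by blast
qed

end
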